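(* As formal power series in $q$, $$U\big(\gamma(q^2)\delta(q)^2\big)=3\xi(q)^2-2\xi(q)^3.$$
   Context: Let $E(q)=\prod_{m\ge1}(1-q^m)$. Define $$\delta(q)=\frac{E(q^4)E(q^6)^2}{E(q)E(q^3)E(q^{12})},\quad \gamma(q)=\frac{E(q)^5E(q^2)^5E(q^6)^5}{E(q^3)^{15}},\quad \xi(q)=\frac{E(q^2)^5E(q^6)}{E(q)E(q^3)^5}.$$ $U$ is the operator on power series given by $U\left(\sum_n a_nq^n\right)=\sum_n a_{2n}q^n$. *)

theory Defs
  imports "HOL-Computational_Algebra.Formal_Power_Series"
begin

text \<open>E(q) = prod_{m>=1} (1 - q^m) as a formal power series over the rationals.
  The n-th coefficient of the infinite product equals the n-th coefficient of the
  finite partial product over m = 1..n (factors with m > n do not affect it).\<close>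
definition Eps :: "rat fps" where
  "Eps = Abs_fps (\<lambda>n. fps_nth (\<Prod>m\<in>{1..n}. (1 - fps_X ^ m)) n)"

definition qsub :: "nat \<Rightarrow> rat fps \<Rightarrow> rat fps" where
  "qsub k f = f oo (fps_X ^ k)"

definition E :: "nat \<Rightarrow> rat fps" where
  "E k = qsub k Eps"

definition delta :: "rat fps" where
  "delta = E 4 * E 6 ^ 2 / (E 1 * E 3 * E 12)"

definition gamma :: "rat fps" where
  "gamma = E 1 ^ 5 * E 2 ^ 5 * E 6 ^ 5 / E 3 ^ 15"

definition xi :: "rat fps" where
  "xi = E 2 ^ 5 * E 6 / (E 1 * E 3 ^ 5)"

definition U :: "rat fps \<Rightarrow> rat fps" where
  "U f = Abs_fps (\<lambda>n. fps_nth f (2 * n))"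

end

theory Submission
  imports Defs "HOL-Computational_Algebra.Formal_Laurent_Series"
begin

text \<open>
  Write \<open>f(a, b)\<close> for Ramanujan's theta function and \<open>e\<^sub>k\<close> for \<open>E(q\<^sup>k)\<close>. The formula
  \<open>f(a, b) f(c, d) = f(ac, bd) f(ad, bc) + a f(ac\<^sup>2d, b/c) f(acd\<^sup>2, b/d)\<close>, valid for \<open>ab = cd\<close>,
  together with the triple product identity, shows that for
  \<open>r = q e\<^sub>2\<^sup>2 e\<^sub>1\<^sub>2\<^sup>4 / (e\<^sub>4\<^sup>4 e\<^sub>6\<^sup>2)\<close> all of \<open>1 + r\<close>, \<open>1 - r\<close> and \<open>1 + 3r\<close> are eta quotients.
  Then \<open>\<delta>\<^sup>2\<close> is an eta quotient in \<open>q\<^sup>2\<close> times \<open>(1 + 3r)(1 - r) = 1 + 2r - 3r\<^sup>2\<close>; since \<open>r\<close> is an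
  odd series, \<open>U\<close> only removes the term \<open>2r\<close> and turns \<open>r\<^sup>2\<close> into a series \<open>t\<close>. Finally
  \<open>1 - r\<^sup>2\<close> being an eta quotient says \<open>1 - t = 1/\<xi>\<close>, and the left-hand side becomes
  \<open>\<xi>\<^sup>3 (1 - 3t) = 3\<xi>\<^sup>2 - 2\<xi>\<^sup>3\<close>.
\<close>

subsection \<open>Agreement of power series up to a given order\<close>

text \<open>Congruence modulo \<open>fps_X ^ n\<close>. Identities between infinite products and
  series are proved as congruences of finite ones for every \<open>n\<close>.\<close>

definition agree :: "nat \<Rightarrow> 'a::comm_ring_1 fps \<Rightarrow> 'a fps \<Rightarrow> bool" where
  "agree n f g \<longleftrightarrow> (\<forall>k<n. fps_nth f k = fps_nth g k)"

lemma agree_refl [simp, intro]: "agree n f f"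
  by (simp add: agree_def)

lemma agree_sym: "agree n f g \<Longrightarrow> agree n g f"
  by (simp add: agree_def)

lemma agree_trans [trans]: "agree n f g \<Longrightarrow> agree n g h \<Longrightarrow> agree n f h"
  by (simp add: agree_def)

lemma agree_mono: "agree n f g \<Longrightarrow> m \<le> n \<Longrightarrow> agree m f g"
  by (auto simp: agree_def)

lemma agree_mult: "agree n f g \<Longrightarrow> agree n f' g' \<Longrightarrow> agree n (f * f') (g * g')"
  by (auto simp: agree_def fps_mult_nth intro!: sum.cong)

lemma agree_sum: "(\<And>i. i \<in> A \<Longrightarrow> agree n (f i) (g i)) \<Longrightarrow> agree n (sum f A) (sum g A)"
  by (auto simp: agree_def fps_sum_nth intro!: sum.cong)

lemma agree_add: "agree n f g \<Longrightarrow> agree n f' g' \<Longrightarrow> agree n (f + f') (g + g')"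
  by (auto simp: agree_def)

lemma agree_prod: "(\<And>i. i \<in> A \<Longrightarrow> agree n (f i) (g i)) \<Longrightarrow> agree n (prod f A) (prod g A)"
  by (induction A rule: infinite_finite_induct) (auto intro: agree_mult)

lemma agree_prod_one: "(\<And>i. i \<in> A \<Longrightarrow> agree n (f i) 1) \<Longrightarrow> agree n (prod f A) 1"
  using agree_prod[of A n f "\<lambda>_. 1"] by simp

lemma agree_eqI: "(\<And>n. agree n f g) \<Longrightarrow> f = g"
  by (auto simp: agree_def fps_eq_iff)

text \<open>A monomial factor q^k gains \<open>k\<close> orders of precision. In the triple product
  this offsets the loss of precision in the outer Gaussian binomials.\<close>

lemma agree_fps_X_power_mult:
  assumes "agree n f g" and "m \<le> k + n"
  shows "agree m (fps_X ^ k * f) (fps_X ^ k * g)"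
  using assms by (auto simp: agree_def fps_X_power_mult_nth)

lemma agree_one_add_monom:
  assumes "n \<le> k"
  shows "agree n (1 + fps_const c * fps_X ^ k) 1" "agree n (1 - fps_X ^ k) 1"
  using assms by (auto simp: agree_def)

lemma agree_cancel_unit:
  fixes u :: "'a::field fps"
  assumes "agree n (f * u) (g * u)" and "fps_nth u 0 \<noteq> 0"
  shows "agree n f g"
proof -
  have "agree n (f * u * inverse u) (g * u * inverse u)"
    by (rule agree_mult[OF assms(1) agree_refl])
  moreover have "h * u * inverse u = h" for h
    using inverse_mult_eq_1'[OF assms(2)] by (simp only: mult.assoc mult_1_right)
  ultimately show ?thesis
    by (simp only:)
qed

subsection \<open>Infinite products\<close>

text \<open>Coefficients are read off truncations, which makes the definition total; for
  \<open>admissible\<close> families the result is the limit of the partial products.\<close>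

definition infprod :: "(nat \<Rightarrow> 'a::comm_ring_1 fps) \<Rightarrow> 'a fps" where
  "infprod g = Abs_fps (\<lambda>n. fps_nth (\<Prod>m<Suc n. g m) n)"

text \<open>A convergence condition: factor \<open>m\<close> is 1 modulo q^(m+1), so factors from
  index \<open>n\<close> on leave all coefficients below q^n unchanged.\<close>

definition admissible :: "(nat \<Rightarrow> 'a::comm_ring_1 fps) \<Rightarrow> bool" where
  "admissible g \<longleftrightarrow> (\<forall>m. agree (Suc m) (g m) 1)"

lemma agree_prod_extend:
  assumes "admissible g" and "n \<le> N"
  shows "agree n (\<Prod>m<N. g m) (\<Prod>m<n. g m)"
proof -
  have "{..<N} = {..<n} \<union> {n..<N}"
    using assms(2) by auto
  then have "(\<Prod>m<N. g m) = (\<Prod>m<n. g m) * (\<Prod>m\<in>{n..<N}. g m)"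
    by (simp add: prod.union_disjoint ivl_disj_int)
  moreover have "agree n (\<Prod>m\<in>{n..<N}. g m) 1"
    using assms(1) by (intro agree_prod_one) (auto simp: admissible_def intro: agree_mono)
  ultimately show ?thesis
    using agree_mult[OF agree_refl] by fastforce
qed

lemma agree_infprod:
  assumes "admissible g" and "n \<le> N"
  shows "agree n (infprod g) (\<Prod>m<N. g m)"
proof -
  have "fps_nth (infprod g) k = fps_nth (\<Prod>m<N. g m) k" if "k < n" for k
    using agree_prod_extend[OF assms(1), of "Suc k" N] that assms(2)
    by (simp add: infprod_def agree_def)
  then show ?thesis
    by (simp add: agree_def)
qed

lemma infprod_eqI:
  assumes "admissible g" and "\<And>n. agree n f (\<Prod>m<n. g m)"
  shows "f = infprod g"
  by (rule agree_eqI) (meson agree_infprod agree_sym agree_trans assms order_refl)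

lemma admissible_mult:
  "admissible g \<Longrightarrow> admissible h \<Longrightarrow> admissible (\<lambda>m. g m * h m)"
  unfolding admissible_def by (metis agree_mult mult_1_right)

lemma infprod_mult:
  assumes "admissible g" and "admissible h"
  shows "infprod g * infprod h = infprod (\<lambda>m. g m * h m)"
  by (rule infprod_eqI)
     (auto simp: prod.distrib intro!: admissible_mult agree_mult agree_infprod assms)

lemma admissible_blocks:
  assumes "admissible h" and "c > 0"
  shows "admissible (\<lambda>m. \<Prod>j<c. h (c * m + j))"
  unfolding admissible_def
proof (intro allI agree_prod_one)
  fix m j
  have "1 * m \<le> c * m"
    using assms(2) by (intro mult_le_mono1) auto
  moreover have "agree (Suc (c * m + j)) (h (c * m + j)) 1"
    using assms(1) by (simp add: admissible_def)
  ultimately show "agree (Suc m) (h (c * m + j)) 1"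
    by (elim agree_mono) linarith
qed

text \<open>The first \<open>n\<close> blocks multiply to the first \<open>c * n\<close> single
  factors, and \<open>c * n\<close> is at least \<open>n\<close>. Grouping of this kind later sorts
  factors by residue class.\<close>

lemma infprod_blocks:
  assumes "admissible h" and "c > 0"
  shows "infprod h = infprod (\<lambda>m. \<Prod>j<c. h (c * m + j))"
proof (rule infprod_eqI)
  show "agree n (infprod h) (\<Prod>m<n. \<Prod>j<c. h (c * m + j))" for n
  proof -
    have "(\<Prod>m<n. \<Prod>j<c. h (c * m + j)) = (\<Prod>i<c * n. h i)"
    proof (induction n)
      case (Suc n)
      have "{..<c * Suc n} = {..<c * n} \<union> {c * n..<c * n + c}"
        by auto
      then have "(\<Prod>i<c * Suc n. h i) = (\<Prod>i<c * n. h i) * (\<Prod>i=c * n..<c * n + c. h i)"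
        by (simp add: prod.union_disjoint ivl_disj_int)
      also have "(\<Prod>i=c * n..<c * n + c. h i) = (\<Prod>j<c. h (c * n + j))"
        by (rule prod.reindex_bij_witness[of _ "\<lambda>j. c * n + j" "\<lambda>i. i - c * n"]) auto
      finally show ?case
        using Suc.IH by simp
    qed simp
    moreover have "1 * n \<le> c * n"
      using assms(2) by (intro mult_le_mono1) auto
    ultimately show ?thesis
      by (simp add: agree_infprod[OF assms(1)])
  qed
qed (rule admissible_blocks[OF assms])

subsection \<open>The finite triple product\<close>

text \<open>Gaussian binomial coefficients in base \<open>Q\<close>. The q-Pascal rule as definition
  avoids division in the ring.\<close>

fun qbin :: "'a::comm_ring_1 \<Rightarrow> nat \<Rightarrow> nat \<Rightarrow> 'a" where
  "qbin Q n 0 = 1"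
| "qbin Q 0 (Suc k) = 0"
| "qbin Q (Suc n) (Suc k) = qbin Q n k + Q ^ Suc k * qbin Q n (Suc k)"

text \<open>The q-shifted factorial (Q;Q)_n.\<close>

definition qpoch :: "'a::comm_ring_1 \<Rightarrow> nat \<Rightarrow> 'a" where
  "qpoch Q n = (\<Prod>i<n. 1 - Q ^ Suc i)"

lemma qbin_eq_0: "n < k \<Longrightarrow> qbin Q n k = 0"
  by (induction Q n k rule: qbin.induct) auto

text \<open>The quotient formula for Gaussian binomials with denominators cleared. The induction
  along the q-Pascal rule rests on 1 - Q^(n+1) = (1 - Q^(k+1)) + Q^(k+1) (1 - Q^(d+1)) for n = k + d
  + 1.\<close>

lemma qbin_qpoch:
  "k \<le> n \<Longrightarrow> qbin Q n k * qpoch Q k * qpoch Q (n - k) = qpoch Q n"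
proof (induction Q n k rule: qbin.induct)
  case (3 Q n k)
  have 1: "qbin Q n k * qpoch Q k * qpoch Q (n - k) = qpoch Q n"
    using 3 by simp
  show ?case
  proof (cases "k = n")
    case True
    then show ?thesis
      using 1 by (simp add: qbin_eq_0 qpoch_def algebra_simps)
  next
    case False
    then obtain d where d: "n = Suc (k + d)"
      using 3(3) less_imp_Suc_add[of k n] by auto
    then have 2: "qbin Q n (Suc k) * qpoch Q (Suc k) * qpoch Q d = qpoch Q n"
      using 3 by simp
    have "qbin Q (Suc n) (Suc k) * qpoch Q (Suc k) * qpoch Q (Suc n - Suc k)
        = (1 - Q ^ Suc k) * (qbin Q n k * qpoch Q k * qpoch Q (n - k))
          + Q ^ Suc k * (1 - Q ^ Suc d) * (qbin Q n (Suc k) * qpoch Q (Suc k) * qpoch Q d)"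
      using d by (simp add: qpoch_def algebra_simps Suc_diff_le)
    also have "\<dots> = (1 - Q ^ Suc n) * qpoch Q n"
      unfolding 1 2 using d by (simp add: algebra_simps power_add)
    finally show ?thesis
      by (simp add: qpoch_def mult.commute)
  qed
qed (auto simp: qpoch_def)

text \<open>The homogeneous form leaves room to put a power of \<open>Q\<close> in place of
  \<open>x\<close>, which is how the triple product arises from it.\<close>

lemma q_binomial_theorem:
  fixes x y Q :: "'a::comm_ring_1"
  shows "(\<Prod>i<n. x + y * Q ^ i) = (\<Sum>k\<le>n. Q ^ (k choose 2) * qbin Q n k * y ^ k * x ^ (n - k))"
proof (induction n arbitrary: y)
  case (Suc n)
  have ch: "Suc k choose 2 = (k choose 2) + k" for k
    by (simp add: numeral_2_eq_2)
  define t where "t k = Q ^ (k choose 2) * Q ^ k * qbin Q n k * y ^ k" for k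
  \<comment> \<open>Splitting off the factor at i = 0 leaves the same product with
    \<open>y * Q\<close> in place of \<open>y\<close>; this is why the induction generalises
    \<open>y\<close>.\<close>
  have "(\<Prod>i<Suc n. x + y * Q ^ i) = (x + y) * (\<Prod>i<n. x + y * Q * Q ^ i)"
    by (simp only: prod.lessThan_Suc_shift) (simp add: mult_ac)
  also have "\<dots> = (x + y) * (\<Sum>k\<le>n. t k * x ^ (n - k))"
    unfolding Suc.IH by (simp add: t_def power_mult_distrib mult_ac)
  also have "\<dots> = (\<Sum>k\<le>n. t k * x ^ (Suc n - k)) + (\<Sum>k\<le>n. y * t k * x ^ (n - k))"
    unfolding distrib_right[of x y] unfolding sum_distrib_left
    by (intro arg_cong2[of _ _ _ _ "(+)"] sum.cong) (auto simp: Suc_diff_le mult_ac)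
  also have "(\<Sum>k\<le>n. t k * x ^ (Suc n - k)) = (\<Sum>k\<le>Suc n. t k * x ^ (Suc n - k))"
    by (simp add: t_def qbin_eq_0)
  also have "\<dots> = t 0 * x ^ Suc n + (\<Sum>k\<le>n. t (Suc k) * x ^ (n - k))"
    by (subst sum.atMost_Suc_shift) simp
  also have "\<dots> + (\<Sum>k\<le>n. y * t k * x ^ (n - k))
      = t 0 * x ^ Suc n + (\<Sum>k\<le>n. (t (Suc k) + y * t k) * x ^ (n - k))"
    by (simp add: sum.distrib distrib_right)
  also have "\<dots> = (\<Sum>k\<le>Suc n. Q ^ (k choose 2) * qbin Q (Suc n) k * y ^ k * x ^ (Suc n - k))"
    by (subst sum.atMost_Suc_shift)
       (auto simp: t_def ch power_add algebra_simps numeral_2_eq_2 intro!: sum.cong)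
  finally show ?case .
qed (simp add: numeral_2_eq_2)

text \<open>This is the q-binomial theorem for 2n factors with Q = zw, x = Q^n and y = z. The lower
  half of the factors yields the product in \<open>w\<close>, the upper half the product in
  \<open>z\<close>, and the terms are re-indexed from the centre k = n.\<close>

lemma finite_triple_product:
  fixes z w :: "'a::idom"
  assumes "z \<noteq> 0" and "w \<noteq> 0"
  shows "(\<Prod>i<n. 1 + z * (z * w) ^ i) * (\<Prod>i<n. 1 + w * (z * w) ^ i)
    = qbin (z * w) (2 * n) n
      + (\<Sum>j=1..n. (z * w) ^ (j choose 2) * z ^ j * qbin (z * w) (2 * n) (n + j))
      + (\<Sum>j=1..n. (z * w) ^ (j choose 2) * w ^ j * qbin (z * w) (2 * n) (n - j))"
    (is "?P1 * ?P2 = ?R")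
proof -
  define Q where "Q = z * w"
  have "Q \<noteq> 0"
    using assms by (simp add: Q_def)
  have ch: "Suc k choose 2 = (k choose 2) + k" for k
    by (simp add: numeral_2_eq_2)
  have ch_add: "(n + j) choose 2 = (n choose 2) + (j choose 2) + n * j" for n j
    by (induction j) (auto simp: ch)
  \<comment> \<open>The monomial pulled out of the 2n factors: z^n Q^(n choose 2) from the lower
    half, Q^(n*n) from the upper half. It is cancelled at the end.\<close>
  define c where "c = z ^ n * Q ^ (n choose 2) * Q ^ (n * n)"
  have "c \<noteq> 0"
    using assms \<open>Q \<noteq> 0\<close> by (simp add: c_def)
  define u where "u k = Q ^ (k choose 2) * qbin Q (2 * n) k * z ^ k * (Q ^ n) ^ (2 * n - k)" for k
  have low: "(\<Prod>i<n. Q ^ n + z * Q ^ i) = z ^ n * Q ^ (n choose 2) * (\<Prod>i<n. 1 + w * Q ^ i)"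
  proof -
    have "(\<Prod>i<n. Q ^ n + z * Q ^ i) = (\<Prod>i<n. z * Q ^ i * (1 + w * Q ^ (n - Suc i)))"
    proof (intro prod.cong refl)
      fix i assume "i \<in> {..<n}"
      then have "n = i + Suc (n - Suc i)"
        by auto
      then have "Q ^ n = Q ^ i * (z * w * Q ^ (n - Suc i))"
        by (metis Q_def power_Suc power_add)
      then show "Q ^ n + z * Q ^ i = z * Q ^ i * (1 + w * Q ^ (n - Suc i))"
        by (simp add: algebra_simps)
    qed
    also have "\<dots> = z ^ n * (\<Prod>i<n. Q ^ i) * (\<Prod>i<n. 1 + w * Q ^ (n - Suc i))"
      by (simp add: prod.distrib)
    also have "(\<Prod>i<n. Q ^ i) = Q ^ (n choose 2)"
      by (induction n) (auto simp: ch power_add numeral_2_eq_2)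
    also have "(\<Prod>i<n. 1 + w * Q ^ (n - Suc i)) = (\<Prod>i<n. 1 + w * Q ^ i)"
      by (rule prod.nat_diff_reindex)
    finally show ?thesis .
  qed
  have high: "(\<Prod>i=n..<2*n. Q ^ n + z * Q ^ i) = Q ^ (n * n) * (\<Prod>i<n. 1 + z * Q ^ i)"
  proof -
    have "(\<Prod>i=n..<2*n. Q ^ n + z * Q ^ i) = (\<Prod>i<n. Q ^ n * (1 + z * Q ^ i))"
      by (rule prod.reindex_bij_witness[of _ "\<lambda>j. n + j" "\<lambda>i. i - n"])
         (auto simp: algebra_simps simp flip: power_add)
    then show ?thesis
      by (simp add: prod.distrib power_mult)
  qed
  have up: "u (n + j) = c * (Q ^ (j choose 2) * z ^ j * qbin Q (2 * n) (n + j))" if "j \<le> n" for j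
  proof -
    have "n * j + n * (2 * n - (n + j)) = n * n"
      using that by (simp add: algebra_simps diff_mult_distrib2)
    then have "Q ^ (n * j) * (Q ^ n) ^ (2 * n - (n + j)) = Q ^ (n * n)"
      by (metis power_add power_mult)
    moreover have "u (n + j) = z ^ n * Q ^ (n choose 2) * (Q ^ (j choose 2) * z ^ j * qbin Q (2 * n) (n + j))
        * (Q ^ (n * j) * (Q ^ n) ^ (2 * n - (n + j)))"
      unfolding u_def ch_add power_add by (simp only: mult_ac)
    ultimately show ?thesis
      by (simp only: c_def mult_ac)
  qed
  have down: "u (n - j) = c * (Q ^ (j choose 2) * w ^ j * qbin Q (2 * n) (n - j))" if "j \<le> n" for j
  proof -
    define d where "d = n - j"
    have d: "n = d + j"
      using that by (simp add: d_def)
    have "(d choose 2) + n * (2 * n - d) = (n choose 2) + (j choose 2) + n * n + j"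
    proof -
      have "2 * (j choose 2) + j = j * j"
        by (induction j) (auto simp: ch)
      then show ?thesis
        unfolding d ch_add by (simp add: algebra_simps)
    qed
    then have 1: "Q ^ (d choose 2) * (Q ^ n) ^ (2 * n - d) = Q ^ (n choose 2) * Q ^ (j choose 2) * Q ^ (n * n) * Q ^ j"
      by (metis power_add power_mult)
    \<comment> \<open>Below the centre \<open>j\<close> factors \<open>z\<close> are missing; since
      Q = zw, the surplus Q^j supplies them and leaves w^j.\<close>
    have 2: "z ^ d * Q ^ j = z ^ n * w ^ j"
      unfolding d Q_def by (simp add: power_add power_mult_distrib)
    have "u d = Q ^ (d choose 2) * (Q ^ n) ^ (2 * n - d) * z ^ d * qbin Q (2 * n) d"
      by (simp only: u_def mult_ac)
    also have "\<dots> = Q ^ (n choose 2) * Q ^ (j choose 2) * Q ^ (n * n) * (z ^ d * Q ^ j) * qbin Q (2 * n) d"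
      unfolding 1 by (simp only: mult_ac)
    finally show ?thesis
      unfolding 2 unfolding c_def d_def by (simp only: mult_ac)
  qed
  have "c * (?P1 * ?P2) = (\<Prod>i<n. Q ^ n + z * Q ^ i) * (\<Prod>i=n..<2*n. Q ^ n + z * Q ^ i)"
    unfolding low high unfolding c_def Q_def by (simp add: mult_ac)
  also have "\<dots> = (\<Prod>i<2*n. Q ^ n + z * Q ^ i)"
  proof -
    have "{..<2*n} = {..<n} \<union> {n..<2*n}"
      by auto
    then show ?thesis
      by (simp add: prod.union_disjoint ivl_disj_int)
  qed
  also have "\<dots> = (\<Sum>k\<le>2*n. u k)"
    by (simp add: q_binomial_theorem u_def)
  also have "{..2*n} = {n} \<union> {Suc n..2*n} \<union> {..<n}"
    by auto
  also have "(\<Sum>k\<in>\<dots>. u k) = u n + (\<Sum>k=Suc n..2*n. u k) + (\<Sum>k<n. u k)"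
    by (subst sum.union_disjoint, force, force, force)+ simp
  also have "(\<Sum>k=Suc n..2*n. u k) = (\<Sum>j=1..n. u (n + j))"
    by (rule sum.reindex_bij_witness[of _ "\<lambda>j. n + j" "\<lambda>k. k - n"]) auto
  also have "(\<Sum>k<n. u k) = (\<Sum>j=1..n. u (n - j))"
    by (rule sum.reindex_bij_witness[of _ "\<lambda>j. n - j" "\<lambda>k. n - k"]) auto
  also have "u n = c * qbin Q (2 * n) n"
    using up[of 0] by (simp add: numeral_2_eq_2)
  also have "(\<Sum>j=1..n. u (n + j)) = c * (\<Sum>j=1..n. Q ^ (j choose 2) * z ^ j * qbin Q (2 * n) (n + j))"
    by (simp add: up sum_distrib_left)
  also have "(\<Sum>j=1..n. u (n - j)) = c * (\<Sum>j=1..n. Q ^ (j choose 2) * w ^ j * qbin Q (2 * n) (n - j))"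
    by (simp add: down sum_distrib_left)
  finally have "c * (?P1 * ?P2) = c * ?R"
    by (simp add: Q_def distrib_left)
  then show ?thesis
    using \<open>c \<noteq> 0\<close> by simp
qed

subsection \<open>Theta series\<close>

text \<open>Triangular numbers at all integers: j(j+1) is even and nonnegative for negative
  \<open>j\<close> as well, so \<open>nat\<close> and \<open>div\<close> lose nothing.\<close>

definition tri :: "int \<Rightarrow> nat" where
  "tri j = nat (j * (j + 1) div 2)"

lemma tri_double: "2 * int (tri j) = j * (j + 1)"
proof -
  have "j * (j + 1) \<ge> 0"
    by (cases "j \<ge> 0") (auto simp: mult_nonpos_nonpos)
  moreover have "even (j * (j + 1))"
    by auto
  ultimately show ?thesis
    by (simp add: tri_def)
qed

text \<open>The exponent of q in the term of index \<open>j\<close> of f(q^a, q^b).\<close>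

definition theta_exp :: "nat \<Rightarrow> nat \<Rightarrow> int \<Rightarrow> nat" where
  "theta_exp a b j = a * tri j + b * tri (j - 1)"

text \<open>Doubling gives a polynomial in \<open>j\<close> over the integers, so equalities of
  exponents become polynomial identities.\<close>

lemma theta_exp_double: "2 * int (theta_exp a b j) = int a * (j * (j + 1)) + int b * (j * (j - 1))"
proof -
  have "2 * int (theta_exp a b j) = int a * (2 * int (tri j)) + int b * (2 * int (tri (j - 1)))"
    by (simp add: theta_exp_def)
  then show ?thesis
    unfolding tri_double by (simp add: mult.commute)
qed

lemma theta_exp_eqI:
  "2 * int (theta_exp a b j) = 2 * int n \<Longrightarrow> theta_exp a b j = n"
  by simp

text \<open>With a, b at least 1 the exponent is at least j^2. Hence each coefficient of a theta
  series is a finite sum, and modulo q^n the indices up to \<open>n\<close> in absolute value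
  suffice.\<close>

lemma theta_exp_ge_abs:
  assumes "a > 0" and "b > 0"
  shows "\<bar>j\<bar> \<le> int (theta_exp a b j)"
proof -
  have "j * (j + 1) \<ge> 0" "j * (j - 1) \<ge> 0"
    using tri_double[of j] tri_double[of "j - 1"] by (auto simp: algebra_simps)
  then have "1 * (j * (j + 1)) + 1 * (j * (j - 1)) \<le> 2 * int (theta_exp a b j)"
    unfolding theta_exp_double using assms by (intro add_mono mult_right_mono) auto
  then have "2 * (j * j) \<le> 2 * int (theta_exp a b j)"
    by (simp add: algebra_simps)
  moreover have "\<bar>j\<bar> * 1 \<le> \<bar>j\<bar> * \<bar>j\<bar>"
    by (cases "j = 0") (auto simp del: abs_mult_self_eq intro!: mult_left_mono)
  ultimately show ?thesis
    by simp
qed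

lemma finite_theta_exp:
  assumes "a > 0" and "b > 0"
  shows "finite {j. theta_exp a b j \<le> n}"
proof (rule finite_subset)
  show "{j. theta_exp a b j \<le> n} \<subseteq> {- int n..int n}"
  proof
    fix j assume "j \<in> {j. theta_exp a b j \<le> n}"
    then show "j \<in> {- int n..int n}"
      using theta_exp_ge_abs[OF assms, of j] by auto
  qed
qed simp

text \<open>The power s^j for an integer \<open>j\<close> when s^2 = 1; only parity matters, so no
  inverse is required.\<close>

definition sign_pow :: "'a::comm_ring_1 \<Rightarrow> int \<Rightarrow> 'a" where
  "sign_pow s j = (if even j then 1 else s)"

lemma power_sign:
  assumes "s * s = 1"
  shows "s ^ j = sign_pow s (int j)" "s ^ j = sign_pow s (- int j)"
  using assms by (induction j) (auto simp: sign_pow_def)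

text \<open>For \<open>s = \<plusminus>1\<close>, \<open>theta a b s\<close> is Ramanujan's \<open>f(sq\<^sup>a, sq\<^sup>b)\<close>.\<close>

definition theta :: "nat \<Rightarrow> nat \<Rightarrow> 'a::comm_ring_1 \<Rightarrow> 'a fps" where
  "theta a b s = Abs_fps (\<lambda>n. \<Sum>j | theta_exp a b j = n. sign_pow s j)"

lemma agree_theta_partial:
  assumes "a > 0" and "b > 0"
  shows "agree n (theta a b s)
    (\<Sum>j\<in>{- int n..int n}. fps_const (sign_pow s j) * fps_X ^ theta_exp a b j)"
  unfolding agree_def
proof (intro allI impI)
  fix k assume "k < n"
  have "j \<in> {- int n..int n}" if "theta_exp a b j = k" for j
    using theta_exp_ge_abs[OF assms, of j] \<open>k < n\<close> that by auto
  then have "{j. theta_exp a b j = k} = {j \<in> {- int n..int n}. theta_exp a b j = k}"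
    by blast
  then have "fps_nth (theta a b s) k
      = (\<Sum>j | j \<in> {- int n..int n} \<and> theta_exp a b j = k. sign_pow s j)"
    by (simp add: theta_def)
  also have "\<dots> = (\<Sum>j\<in>{- int n..int n}. if theta_exp a b j = k then sign_pow s j else 0)"
    by (subst sum.inter_filter) auto
  also have "\<dots> = fps_nth (\<Sum>j\<in>{- int n..int n}. fps_const (sign_pow s j) * fps_X ^ theta_exp a b j) k"
    by (auto simp: fps_sum_nth intro!: sum.cong)
  finally show "fps_nth (theta a b s) k = \<dots>" .
qed

section \<open>Jacobi's triple product as the limit of the finite one\<close>

lemma agree_qpoch:
  fixes d :: nat
  defines "Q \<equiv> (fps_X :: 'a::comm_ring_1 fps) ^ d"
  assumes "m \<le> M" and "m \<le> N" and "d > 0"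
  shows "agree (Suc m) (qpoch Q M) (qpoch Q N)"
proof -
  have *: "agree (Suc m) (qpoch Q N) (qpoch Q m)" if "m \<le> N" for N
  proof -
    have "{..<N} = {..<m} \<union> {m..<N}"
      using that by auto
    then have "qpoch Q N = qpoch Q m * (\<Prod>i\<in>{m..<N}. 1 - Q ^ Suc i)"
      unfolding qpoch_def by (simp add: prod.union_disjoint ivl_disj_int)
    moreover have "agree (Suc m) (\<Prod>i\<in>{m..<N}. 1 - Q ^ Suc i) 1"
    proof (rule agree_prod_one)
      fix i assume "i \<in> {m..<N}"
      moreover have "1 * Suc i \<le> d * Suc i"
        using \<open>d > 0\<close> by (intro mult_le_mono1) auto
      ultimately show "agree (Suc m) (1 - Q ^ Suc i) 1"
        unfolding Q_def power_mult[symmetric] by (intro agree_one_add_monom) auto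
    qed
    ultimately show ?thesis
      using agree_mult[OF agree_refl[of "Suc m" "qpoch Q m"]] by fastforce
  qed
  show ?thesis
    using *[OF assms(2)] *[OF assms(3)] agree_sym agree_trans by blast
qed

text \<open>The left side is (Q;Q)_n (Q;Q)_2n / ((Q;Q)_k (Q;Q)_l). All four indices are at least
  \<open>m\<close>, so the symbols coincide modulo q^(m+1), and the denominator is a unit with
  constant term 1.\<close>

lemma agree_qpoch_qbin:
  fixes d :: nat
  defines "Q \<equiv> (fps_X :: 'a::field fps) ^ d"
  assumes "d > 0" and "k + l = 2 * n" and "m \<le> k" and "m \<le> l"
  shows "agree (Suc m) (qpoch Q n * qbin Q (2 * n) k) 1"
proof (rule agree_cancel_unit)
  note ag = agree_qpoch[OF _ _ assms(2), folded Q_def]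
  have "l = 2 * n - k"
    using assms by simp
  then have "qbin Q (2 * n) k * qpoch Q k * qpoch Q l = qpoch Q (2 * n)"
    using qbin_qpoch[of k "2 * n" Q] assms(3) by auto
  then have "qpoch Q n * qbin Q (2 * n) k * (qpoch Q k * qpoch Q l) = qpoch Q n * qpoch Q (2 * n)"
    by (simp add: mult_ac)
  also have "agree (Suc m) \<dots> (1 * (qpoch Q k * qpoch Q l))"
    using assms by (simp) (intro agree_mult ag, auto)
  finally show "agree (Suc m) (qpoch Q n * qbin Q (2 * n) k * (qpoch Q k * qpoch Q l))
      (1 * (qpoch Q k * qpoch Q l))" .
  have "fps_nth (qpoch Q i) 0 = 1" for i
    using agree_qpoch[OF _ _ assms(2), of 0 i 0] by (simp add: agree_def qpoch_def[of _ 0] Q_def)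
  then show "fps_nth (qpoch Q k * qpoch Q l) 0 \<noteq> 0"
    by simp
qed

lemma admissible_one_minus_monom:
  "(\<And>m. Suc m \<le> e m) \<Longrightarrow> admissible (\<lambda>m. 1 - fps_X ^ e m)"
  by (simp add: admissible_def agree_one_add_monom)

lemma admissible_one_plus_monom:
  "(\<And>m. Suc m \<le> e m) \<Longrightarrow> admissible (\<lambda>m. 1 + fps_const c * fps_X ^ e m)"
  by (simp add: admissible_def agree_one_add_monom)

theorem jacobi_triple_product:
  fixes s :: "'a::field"
  assumes "a > 0" and "b > 0" and s: "s * s = 1"
  shows "theta a b s = infprod (\<lambda>m. (1 - fps_X ^ ((a + b) * Suc m))
    * ((1 + fps_const s * fps_X ^ ((a + b) * m + a)) * (1 + fps_const s * fps_X ^ ((a + b) * m + b))))"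
proof (rule infprod_eqI)
  have mono: "m \<le> (a + b) * m" for m
    using mult_le_mono1[of 1 "a + b" m] assms by simp
  have "Suc m \<le> (a + b) * m + a" "Suc m \<le> (a + b) * m + b" for m
    using mono[of m] assms(1,2) by linarith+
  then show "admissible (\<lambda>m. (1 - fps_X ^ ((a + b) * Suc m))
    * ((1 + fps_const s * fps_X ^ ((a + b) * m + a)) * (1 + fps_const s * fps_X ^ ((a + b) * m + b))))"
    by (intro admissible_mult admissible_one_minus_monom admissible_one_plus_monom mono)
next
  fix n
  \<comment> \<open>The sign squares to 1, so \<open>z * w\<close> is the plain power
    q^(a+b).\<close>
  define z w Q where "z = fps_const s * fps_X ^ a" and "w = fps_const s * fps_X ^ b"
    and "Q = (fps_X :: 'a fps) ^ (a + b)"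
  have "z * w = fps_const (s * s) * (fps_X ^ a * fps_X ^ b)"
    by (simp only: z_def w_def fps_const_mult[symmetric] mult_ac)
  then have Q: "z * w = Q"
    by (simp add: s Q_def power_add)
  have "s \<noteq> 0"
    using s by auto
  then have nz: "z \<noteq> 0" "w \<noteq> 0"
    by (auto simp: z_def w_def)
  define M where "M j = fps_const (sign_pow s j) * fps_X ^ theta_exp a b j" for j
  define B where "B k = qpoch Q n * qbin Q (2 * n) k" for k
  have ch: "2 * int (j choose 2) = int j * (int j - 1)" for j
    by (induction j) (auto simp: numeral_2_eq_2 algebra_simps)
  \<comment> \<open>The terms of the finite identity are the theta terms: powers of \<open>z\<close>
    give nonnegative indices, powers of \<open>w\<close> nonpositive ones.\<close>
  have Mz: "Q ^ (j choose 2) * z ^ j = M (int j)" for j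
  proof -
    have "theta_exp a b (int j) = (a + b) * (j choose 2) + a * j"
    proof (rule theta_exp_eqI)
      have *: "2 * int ((a + b) * (j choose 2) + a * j) = (int a + int b) * (2 * int (j choose 2)) + 2 * int a * int j"
        by (simp add: algebra_simps)
      show "2 * int (theta_exp a b (int j)) = 2 * int ((a + b) * (j choose 2) + a * j)"
        unfolding * ch theta_exp_double by (simp add: algebra_simps)
    qed
    then show ?thesis
      using power_sign(1)[OF s, of j]
      by (simp add: M_def Q_def z_def power_mult_distrib fps_const_power power_add power_mult mult_ac)
  qed
  have Mw: "Q ^ (j choose 2) * w ^ j = M (- int j)" for j
  proof -
    have "theta_exp a b (- int j) = (a + b) * (j choose 2) + b * j"
    proof (rule theta_exp_eqI)
      have *: "2 * int ((a + b) * (j choose 2) + b * j) = (int a + int b) * (2 * int (j choose 2)) + 2 * int b * int j"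
        by (simp add: algebra_simps)
      show "2 * int (theta_exp a b (- int j)) = 2 * int ((a + b) * (j choose 2) + b * j)"
        unfolding * ch theta_exp_double by (simp add: algebra_simps)
    qed
    then show ?thesis
      using power_sign(2)[OF s, of j]
      by (simp add: M_def Q_def w_def power_mult_distrib fps_const_power power_add power_mult mult_ac)
  qed
  have X: "fps_X ^ ((a + b) * k) = Q ^ k" "fps_X ^ ((a + b) * k + c) = fps_X ^ c * Q ^ k" for k c
    unfolding Q_def power_mult by (simp_all add: power_add power_mult)
  \<comment> \<open>For k, l = n + i, n - i the factor \<open>B k\<close> is 1 only up to about
    order n - |i|; the exponent in \<open>M i\<close> is at least |i| and makes up the
    difference.\<close>
  have agree_M: "agree n (M i) (M i * B k)"
    if "k + l = 2 * n" "n \<le> k + nat \<bar>i\<bar>" "n \<le> l + nat \<bar>i\<bar>" for i k l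
  proof -
    have "agree (Suc (min k l)) (B k) 1"
      unfolding B_def Q_def using assms that by (intro agree_qpoch_qbin) auto
    then have "agree n (fps_X ^ theta_exp a b i * B k) (fps_X ^ theta_exp a b i * 1)"
      using theta_exp_ge_abs[OF assms(1,2), of i] that
      by (elim agree_fps_X_power_mult) linarith
    then show ?thesis
      unfolding M_def by (simp only: mult.assoc) (intro agree_mult agree_refl, simp add: agree_sym)
  qed
  have "agree n (theta a b s) (\<Sum>j\<in>{- int n..int n}. M j)"
    unfolding M_def by (rule agree_theta_partial[OF assms(1,2)])
  also have "(\<Sum>j\<in>{- int n..int n}. M j) = M 0 + (\<Sum>j=1..n. M (int j)) + (\<Sum>j=1..n. M (- int j))"
  proof -
    have "{- int n..int n} = {0} \<union> {1..int n} \<union> {- int n..-1}"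
      by auto
    then have "(\<Sum>j\<in>{- int n..int n}. M j) = M 0 + (\<Sum>j\<in>{1..int n}. M j) + (\<Sum>j\<in>{- int n..-1}. M j)"
      by (simp add: sum.union_disjoint)
    moreover have "(\<Sum>j\<in>{1..int n}. M j) = (\<Sum>j=1..n. M (int j))"
      by (rule sum.reindex_bij_witness[of _ int nat]) auto
    moreover have "(\<Sum>j\<in>{- int n..-1}. M j) = (\<Sum>j=1..n. M (- int j))"
      by (rule sum.reindex_bij_witness[of _ "\<lambda>j. - int j" "\<lambda>j. nat (- j)"]) auto
    ultimately show ?thesis
      by simp
  qed
  also have "agree n \<dots> (M 0 * B n + (\<Sum>j=1..n. M (int j) * B (n + j)) + (\<Sum>j=1..n. M (- int j) * B (n - j)))"
  proof (intro agree_add agree_sum)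
    show "agree n (M 0) (M 0 * B n)"
      by (rule agree_M[of _ n]) auto
    show "agree n (M (int j)) (M (int j) * B (n + j))" if "j \<in> {1..n}" for j
      by (rule agree_M[of _ "n - j"]) (use that in auto)
    show "agree n (M (- int j)) (M (- int j) * B (n - j))" if "j \<in> {1..n}" for j
      by (rule agree_M[of _ "n + j"]) (use that in auto)
  qed
  also have "M 0 = 1"
    using Mz[of 0] by (simp add: numeral_2_eq_2)
  also have "1 * B n + (\<Sum>j=1..n. M (int j) * B (n + j)) + (\<Sum>j=1..n. M (- int j) * B (n - j))
      = qpoch Q n * ((\<Prod>i<n. 1 + z * (z * w) ^ i) * (\<Prod>i<n. 1 + w * (z * w) ^ i))"
    unfolding finite_triple_product[OF nz] unfolding Q Mz Mw B_def
    by (simp add: distrib_left sum_distrib_left mult_ac)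
  also have "\<dots> = (\<Prod>m<n. (1 - fps_X ^ ((a + b) * Suc m))
    * ((1 + fps_const s * fps_X ^ ((a + b) * m + a)) * (1 + fps_const s * fps_X ^ ((a + b) * m + b))))"
    unfolding Q prod.distrib[symmetric] qpoch_def
    unfolding X z_def w_def by (simp only: mult_ac)
  finally show "agree n (theta a b s) \<dots>" .
qed

section \<open>Products of two theta series\<close>

lemma fps_nth_theta_mult:
  assumes "a > 0" "b > 0" "c > 0" "d > 0"
  shows "finite {(i, j). theta_exp a b i + theta_exp c d j = n}" (is "finite ?S")
    and "fps_nth (theta a b s * theta c d t) n
      = (\<Sum>(i, j) | theta_exp a b i + theta_exp c d j = n. sign_pow s i * sign_pow t j)"
proof -
  let ?A = "\<lambda>k. {i. theta_exp a b i = k}" and ?C = "\<lambda>k. {i. theta_exp c d i = k}"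
  have finA: "finite (?A k)" for k
    by (rule finite_subset[OF _ finite_theta_exp[OF assms(1,2), of k]]) auto
  have finC: "finite (?C k)" for k
    by (rule finite_subset[OF _ finite_theta_exp[OF assms(3,4), of k]]) auto
  have S: "?S = (\<Union>k\<in>{0..n}. ?A k \<times> ?C (n - k))"
    by auto
  show "finite ?S"
    unfolding S by (intro finite_UN_I finite_cartesian_product finA finC) auto
  have "fps_nth (theta a b s * theta c d t) n
      = (\<Sum>k=0..n. \<Sum>(i, j)\<in>?A k \<times> ?C (n - k). sign_pow s i * sign_pow t j)"
    by (simp add: fps_mult_nth theta_def sum_product sum.cartesian_product)
  also have "\<dots> = (\<Sum>(i, j)\<in>?S. sign_pow s i * sign_pow t j)"
    unfolding S by (rule sum.UNION_disjoint[symmetric]) (auto simp: finA finC)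
  finally show "fps_nth (theta a b s * theta c d t) n
      = (\<Sum>(i, j) | theta_exp a b i + theta_exp c d j = n. sign_pow s i * sign_pow t j)" .
qed

text \<open>The index pairs (p, q) of the double sum are split by the parity of p + q: even pairs
  are (i + j, i - j), odd pairs are (i + j + 1, i - j). The bounds \<open>c < b\<close> and
  \<open>d < b\<close> keep the exponents b - c and b - d positive.\<close>

theorem theta_mult_theta:
  fixes s t :: "'a::comm_ring_1"
  assumes ab: "a + b = c + d" and bc: "c < b" and bd: "d < b" and pos: "a > 0" "c > 0" "d > 0"
    and s: "s * s = 1" and t: "t * t = 1"
  shows "theta a b s * theta c d t
    = theta (a + c) (b + d) (s * t) * theta (a + d) (b + c) (s * t)
      + fps_const s * fps_X ^ a
        * (theta (a + 2 * c + d) (b - c) (s * t) * theta (a + c + 2 * d) (b - d) (s * t))"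
    (is "?L = ?R1 + fps_const s * fps_X ^ a * ?R2")
proof (rule fps_ext)
  fix n
  let ?g = "\<lambda>(i, j). sign_pow s i * sign_pow t j"
  let ?h = "\<lambda>(i, j). sign_pow (s * t) i * sign_pow (s * t) j"
  let ?S = "{(i, j). theta_exp a b i + theta_exp c d j = n}"
  let ?E = "{(i, j). theta_exp (a + c) (b + d) i + theta_exp (a + d) (b + c) j = n}"
  let ?O = "{(i, j). a + (theta_exp (a + 2 * c + d) (b - c) i + theta_exp (a + c + 2 * d) (b - d) j) = n}"
  have b: "b > 0" "int b = int c + int d - int a"
    using bc ab by linarith+
  have nat_eqI: "x = y" if "2 * int x = 2 * int y" for x y
    using that by simp
  \<comment> \<open>As a + b = c + d, the quadratic part is a multiple of p^2 + q^2 = 2(i^2 + j^2),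
    so no mixed term i*j appears.\<close>
  have e1: "theta_exp a b (i + j) + theta_exp c d (i - j)
      = theta_exp (a + c) (b + d) i + theta_exp (a + d) (b + c) j" for i j
    by (rule nat_eqI)
       (simp only: of_nat_add distrib_left[of 2] theta_exp_double, simp add: b algebra_simps)
  \<comment> \<open>The shift by 1 produces the constant \<open>a\<close>, the exponent of the term
    of index 1 in the first series.\<close>
  have e2: "theta_exp a b (i + j + 1) + theta_exp c d (i - j)
      = a + (theta_exp (a + 2 * c + d) (b - c) i + theta_exp (a + c + 2 * d) (b - d) j)" for i j
    by (rule nat_eqI) (auto simp: distrib_left[of 2] theta_exp_double of_nat_diff bc bd less_imp_le b algebra_simps)
  have sst: "s * (s * x) = x" "t * (t * x) = x" for x
    using s t by (simp_all flip: mult.assoc)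
  have s1: "sign_pow s (i + j) * sign_pow t (i - j) = sign_pow (s * t) i * sign_pow (s * t) j" for i j
    by (auto simp: sign_pow_def s t sst mult_ac)
  have s2: "sign_pow s (i + j + 1) * sign_pow t (i - j)
      = s * (sign_pow (s * t) i * sign_pow (s * t) j)" for i j
    by (auto simp: sign_pow_def s t sst mult_ac)
  have even_iff: "(p + q) div 2 + (p - q) div 2 = p" "(p + q) div 2 - (p - q) div 2 = q"
    if "even p \<longleftrightarrow> even q" for p q :: int
    using that by presburger+
  have odd_iff: "(p + q - 1) div 2 + (p - q - 1) div 2 + 1 = p" "(p + q - 1) div 2 - (p - q - 1) div 2 = q"
    if "even p \<longleftrightarrow> odd q" for p q :: int
    using that by presburger+
  have "fps_nth ?L n = sum ?g ?S"
    by (rule fps_nth_theta_mult) (use pos b in auto)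
  also have "?S = {p \<in> ?S. even (fst p + snd p)} \<union> {p \<in> ?S. odd (fst p + snd p)}"
    by blast
  also have "sum ?g \<dots> = sum ?g {p \<in> ?S. even (fst p + snd p)} + sum ?g {p \<in> ?S. odd (fst p + snd p)}"
    by (rule sum.union_disjoint) (use fps_nth_theta_mult(1)[of a b c d n] pos b in \<open>auto\<close>)
  also have "sum ?g {p \<in> ?S. even (fst p + snd p)} = sum ?h ?E"
    by (rule sum.reindex_bij_witness[of _ "\<lambda>(i, j). (i + j, i - j)"
          "\<lambda>(i, j). ((i + j) div 2, (i - j) div 2)"])
       (auto simp: even_iff simp flip: e1 s1)
  also have "sum ?h ?E = fps_nth ?R1 n"
    by (rule fps_nth_theta_mult(2)[symmetric]) (use pos b in auto)
  also have "sum ?g {p \<in> ?S. odd (fst p + snd p)} = (\<Sum>p\<in>?O. s * ?h p)"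
    by (rule sum.reindex_bij_witness[of _ "\<lambda>(i, j). (i + j + 1, i - j)"
          "\<lambda>(i, j). ((i + j - 1) div 2, (i - j - 1) div 2)"])
       (auto simp: odd_iff simp flip: e2 s2)
  also have "\<dots> = s * sum ?h ?O"
    by (simp add: sum_distrib_left)
  also have "sum ?h ?O = fps_nth (fps_X ^ a * ?R2) n"
  proof (cases "n < a")
    case False
    then have "?O = {(i, j). theta_exp (a + 2 * c + d) (b - c) i + theta_exp (a + c + 2 * d) (b - d) j = n - a}"
      by auto
    moreover have "fps_nth ?R2 (n - a) = sum ?h \<dots>"
      by (rule fps_nth_theta_mult(2)) (use pos bc bd in auto)
    ultimately show ?thesis
      using False by (simp only: fps_X_power_mult_nth) simp
  qed (auto simp: fps_X_power_mult_nth)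
  finally show "fps_nth ?L n = fps_nth (?R1 + fps_const s * fps_X ^ a * ?R2) n"
    by (simp add: mult.assoc)
qed

subsection \<open>Products over arithmetic progressions\<close>

text \<open>The product (q^r; q^N) to infinity.\<close>

definition pochhammer_inf :: "nat \<Rightarrow> nat \<Rightarrow> 'a::comm_ring_1 fps" where
  "pochhammer_inf r N = infprod (\<lambda>m. 1 - fps_X ^ (N * m + r))"

lemma admissible_progression:
  "0 < r \<Longrightarrow> 0 < N \<Longrightarrow> admissible (\<lambda>m. 1 - fps_X ^ (N * m + r))"
proof (rule admissible_one_minus_monom)
  fix m assume "0 < r" "0 < N"
  then show "Suc m \<le> N * m + r"
    using mult_le_mono1[of 1 N m] by linarith
qed

text \<open>The exponents N m + r are sorted by the residue of \<open>m\<close> modulo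
  \<open>c\<close>. This brings all products to the common modulus 12.\<close>

lemma pochhammer_inf_split:
  assumes "0 < r" "0 < N" "0 < c"
  shows "pochhammer_inf r N = (\<Prod>j<c. pochhammer_inf (r + j * N) (c * N))"
proof -
  let ?f = "\<lambda>j m. 1 - (fps_X :: 'a fps) ^ (c * N * m + (r + j * N))"
  have "infprod (\<lambda>m. \<Prod>j<k. ?f j m) = (\<Prod>j<k. infprod (?f j)) \<and> admissible (\<lambda>m. \<Prod>j<k. ?f j m)" for k
  proof (induction k)
    case 0
    then show ?case
      by (auto simp: admissible_def infprod_def fps_eq_iff)
  next
    case (Suc k)
    have "admissible (?f k)"
      using assms by (intro admissible_progression) auto
    with Suc infprod_mult[of "\<lambda>m. \<Prod>j<k. ?f j m" "?f k"] show ?case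
      by (simp add: admissible_mult)
  qed
  moreover have "pochhammer_inf r N = infprod (\<lambda>m. \<Prod>j<c. ?f j m)"
    unfolding pochhammer_inf_def
    by (subst infprod_blocks[OF admissible_progression assms(3)]) (use assms in \<open>auto simp: algebra_simps\<close>)
  ultimately show ?thesis
    by (simp add: pochhammer_inf_def)
qed

lemma pochhammer_inf_nth_0:
  assumes "0 < r" "0 < N"
  shows "fps_nth (pochhammer_inf r N) 0 = 1"
  using agree_infprod[OF admissible_progression[OF assms], of 1 1] assms
  by (simp add: agree_def pochhammer_inf_def)

lemma pochhammer_inf_nonzero: "0 < r \<Longrightarrow> 0 < N \<Longrightarrow> pochhammer_inf r N \<noteq> 0"
  using pochhammer_inf_nth_0[of r N] by (metis fps_zero_nth zero_neq_one)

section \<open>Theta series as products over arithmetic progressions\<close>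

lemma theta_minus_one:
  assumes "a > 0" and "b > 0"
  shows "theta a b (-1 :: 'a::field)
    = pochhammer_inf (a + b) (a + b) * (pochhammer_inf a (a + b) * pochhammer_inf b (a + b))"
proof -
  have "(1 :: 'a fps) + fps_const (-1) * fps_X ^ k = 1 - fps_X ^ k" for k
    by (simp flip: fps_const_neg)
  moreover have "(a + b) * Suc m = (a + b) * m + (a + b)" for m
    by simp
  ultimately show ?thesis
    unfolding pochhammer_inf_def using assms
    by (simp only: jacobi_triple_product infprod_mult admissible_mult admissible_progression
        add_pos_pos mult_minus1 minus_minus mult_1_right)
qed

text \<open>Each factor 1 + q^k of the triple product equals (1 - q^(2k)) / (1 - q^k); the
  denominators are moved to the left.\<close>

lemma theta_one:
  assumes "a > 0" and "b > 0"
  shows "theta a b (1 :: 'a::field) * (pochhammer_inf a (a + b) * pochhammer_inf b (a + b))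
    = pochhammer_inf (a + b) (a + b)
      * (pochhammer_inf (2 * a) (2 * (a + b)) * pochhammer_inf (2 * b) (2 * (a + b)))"
proof -
  let ?u = "\<lambda>k. 1 - (fps_X :: 'a fps) ^ k" and ?v = "\<lambda>k. 1 + fps_const (1 :: 'a) * fps_X ^ k"
  have uv: "?v k * ?u k = ?u (2 * k)" for k
    by (simp add: algebra_simps power_mult power2_eq_square flip: power_mult_distrib power_add mult_2)
  have le: "Suc m \<le> (a + b) * m + c" if "c > 0" for m c
    using mult_le_mono1[of 1 "a + b" m] assms that by linarith
  have adm: "admissible (\<lambda>m. ?v ((a + b) * m + c))" "admissible (\<lambda>m. ?u ((a + b) * m + c))"
    "admissible (\<lambda>m. ?u (2 * (a + b) * m + 2 * c))" if "c > 0" for c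
    using assms that by (intro admissible_one_plus_monom le admissible_progression; simp)+
  have S: "(a + b) * Suc m = (a + b) * m + (a + b)" for m
    by simp
  have D: "2 * ((a + b) * m + c) = 2 * (a + b) * m + 2 * c" for m c
    by simp
  have "theta a b (1 :: 'a) * (pochhammer_inf a (a + b) * pochhammer_inf b (a + b))
    = infprod (\<lambda>m. ?u ((a + b) * m + (a + b)) * (?v ((a + b) * m + a) * ?v ((a + b) * m + b))
        * (?u ((a + b) * m + a) * ?u ((a + b) * m + b)))"
    unfolding pochhammer_inf_def jacobi_triple_product[OF assms mult_1_right] S
    using assms by (simp only: infprod_mult admissible_mult adm add_pos_pos)
  also have "\<dots> = infprod (\<lambda>m. ?u ((a + b) * m + (a + b))
      * ((?v ((a + b) * m + a) * ?u ((a + b) * m + a)) * (?v ((a + b) * m + b) * ?u ((a + b) * m + b))))"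
    by (simp only: mult_ac)
  also have "\<dots> = pochhammer_inf (a + b) (a + b)
      * (pochhammer_inf (2 * a) (2 * (a + b)) * pochhammer_inf (2 * b) (2 * (a + b)))"
    unfolding uv D pochhammer_inf_def
    using assms by (simp only: infprod_mult admissible_mult adm add_pos_pos)
  finally show ?thesis .
qed

section \<open>The substitution q -> q^k, the series E(q^k) and the operator U\<close>

lemma qsub_const [simp]: "qsub k 1 = 1" "qsub k (numeral n) = numeral n"
  by (simp_all add: qsub_def fps_numeral_fps_const)

lemma qsub_ring_hom:
  assumes "k > 0"
  shows "qsub k (f + g) = qsub k f + qsub k g" "qsub k (f - g) = qsub k f - qsub k g"
    "qsub k (f * g) = qsub k f * qsub k g" "qsub k (f ^ n) = qsub k f ^ n"
    "qsub k (fps_X ^ n) = fps_X ^ (k * n)" "qsub k fps_X = fps_X ^ k"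
proof -
  show mult: "qsub k (f * g) = qsub k f * qsub k g" for f g
    using assms unfolding qsub_def by (intro fps_compose_mult_distrib) simp
  show pow: "qsub k (f ^ n) = qsub k f ^ n" for f n
    by (induction n) (simp_all add: mult)
  show X: "qsub k fps_X = fps_X ^ k"
    using assms by (simp add: qsub_def)
  show "qsub k (fps_X ^ n) = fps_X ^ (k * n)"
    by (simp add: pow X power_mult)
qed (simp_all add: qsub_def fps_compose_add_distrib fps_compose_sub_distrib)

lemma agree_qsub: "agree n f g \<Longrightarrow> agree n (qsub k f) (qsub k g)"
  by (auto simp: agree_def qsub_def fps_compose_nth intro!: sum.cong)

lemma E_eq_pochhammer_inf:
  assumes "k > 0"
  shows "E k = pochhammer_inf k k"
proof -
  let ?g = "\<lambda>m. 1 - (fps_X :: rat fps) ^ Suc m"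
  have adm: "admissible ?g"
    by (intro admissible_one_minus_monom) simp
  have "fps_nth Eps n = fps_nth (infprod ?g) n" for n
  proof -
    have "(\<Prod>m\<in>{1..n}. 1 - (fps_X :: rat fps) ^ m) = (\<Prod>m<n. ?g m)"
      by (rule prod.reindex_bij_witness[of _ Suc "\<lambda>m. m - 1"]) auto
    \<comment> \<open>\<open>infprod\<close> uses one factor more than \<open>Eps\<close> does,
      namely 1 - q^(n+1), which leaves the coefficient of q^n unchanged.\<close>
    moreover have "agree (Suc n) ((\<Prod>m<n. ?g m) * ?g n) ((\<Prod>m<n. ?g m) * 1)"
      by (intro agree_mult agree_one_add_monom) auto
    ultimately show ?thesis
      by (simp add: Eps_def infprod_def agree_def)
  qed
  then have Eps: "Eps = infprod ?g"
    by (simp add: fps_eq_iff)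
  show ?thesis
    unfolding pochhammer_inf_def
  proof (rule infprod_eqI)
    show "admissible (\<lambda>m. 1 - (fps_X :: rat fps) ^ (k * m + k))"
      using assms by (intro admissible_progression)
    have "qsub k (\<Prod>m<n. ?g m) = (\<Prod>m<n. 1 - fps_X ^ (k * m + k))" for n
      by (induction n)
        (simp_all only: prod.lessThan_Suc lessThan_0 prod.empty qsub_ring_hom(2,3,5)[OF assms] qsub_const
          mult_Suc_right add.commute)
    then show "agree n (E k) (\<Prod>m<n. 1 - fps_X ^ (k * m + k))" for n
      using agree_qsub[OF agree_infprod[OF adm order_refl], of n k] by (simp add: E_def Eps)
  qed
qed

lemma E_nth_0: "k > 0 \<Longrightarrow> fps_nth (E k) 0 = 1"
  by (simp add: E_eq_pochhammer_inf pochhammer_inf_nth_0)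

lemma qsub_E:
  assumes "j > 0" "k > 0"
  shows "qsub j (E k) = E (j * k)"
proof -
  have "Eps oo (fps_X ^ k) oo (fps_X ^ j) = Eps oo (fps_X ^ k oo (fps_X ^ j))"
    using assms by (intro fps_compose_assoc[symmetric]) auto
  also have "fps_X ^ k oo (fps_X ^ j) = (fps_X :: rat fps) ^ (j * k)"
    using qsub_ring_hom(5)[OF assms(1)] by (simp add: qsub_def)
  finally show ?thesis
    by (simp add: E_def qsub_def)
qed

lemma U_even_plus_odd: "U (qsub 2 f + fps_X * qsub 2 g) = f"
proof (rule fps_ext)
  fix n
  have "fps_nth (fps_X * qsub 2 g) (2 * n) = 0"
    by (cases n) (simp_all add: qsub_def fps_nth_compose_X_power)
  then show "fps_nth (U (qsub 2 f + fps_X * qsub 2 g)) n = fps_nth f n"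
    by (simp add: U_def qsub_def fps_nth_compose_X_power)
qed

lemma qsub_2_inject: "qsub 2 f = qsub 2 g \<longleftrightarrow> f = g"
  using U_even_plus_odd[of _ 0] by (metis (no_types) qsub_def fps_compose_0 mult_zero_right)

subsection \<open>Relations of level 12\<close>

text \<open>Pure elimination. Here \<open>x\<close> stands for q; \<open>w\<close> and
  \<open>s\<close> for the products over exponents 0 and 6 modulo 12; \<open>S\<close>,
  \<open>D\<close>, \<open>V\<close>, \<open>y\<close>, \<open>z\<close> for those over
  \<plusminus>4, \<plusminus>2, \<plusminus>3, \<plusminus>5, \<plusminus>1. The \<open>t\<close>s
  are theta series, unprimed with sign 1 and primed with sign -1.\<close>

lemma level_12_relations:
  fixes x r S D V s w y z t1 t1' t2 t2' t3 t3' :: "'a::idom"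
  assumes nz: "S \<noteq> 0" "V \<noteq> 0" "w \<noteq> 0" "y \<noteq> 0" "z \<noteq> 0"
    and t1: "t1 * (y * z) = s * w * D" and t1': "t1' = s * w * (y * z)"
    and t2: "t2 * (D * S) = s * w * S" and t2': "t2' = s * w * (D * S)"
    and t3: "t3 * V\<^sup>2 = s * w * s\<^sup>2" and t3': "t3' = s * w * V\<^sup>2"
    and a: "t1 * t3' = (w * S)\<^sup>2 + x * (w * D)\<^sup>2"
    and b: "t1' * t3 = (w * S)\<^sup>2 - x * (w * D)\<^sup>2"
    and c: "t1 * t2' = w * V * (w * y + x * (w * z))"
    and d: "t1' * t2 = w * V * (w * y - x * (w * z))"
    and r: "r * S\<^sup>2 = x * D\<^sup>2"
  shows "(1 - r\<^sup>2) * S ^ 4 = s ^ 6 * D"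
    and "(1 + 3 * r) * (1 - r) * ((y * z)\<^sup>2 * V ^ 4 * S\<^sup>2) = D ^ 6 * s ^ 8"
proof -
  define e where "e = y * z"
  have "e \<noteq> 0"
    using nz by (simp add: e_def)
  \<comment> \<open>Each of \<open>A\<close>, \<open>B\<close>, \<open>C\<close>, \<open>D\<close>
    evaluates a product of two theta series in two ways: as a sum by \<open>a\<close> to
    \<open>d\<close>, and as a product by the relations for the \<open>t\<close>s.\<close>
  have "w\<^sup>2 * (e * S\<^sup>2 * (1 + r)) = e * ((w * S)\<^sup>2 + x * (w * D)\<^sup>2)"
    using r by algebra
  also have "\<dots> = w\<^sup>2 * (s\<^sup>2 * D * V\<^sup>2)"
    using t1 t3' unfolding a[symmetric] e_def by algebra
  finally have A: "e * S\<^sup>2 * (1 + r) = s\<^sup>2 * D * V\<^sup>2"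
    using nz by simp
  have "w\<^sup>2 * (S\<^sup>2 * V\<^sup>2 * (1 - r)) = V\<^sup>2 * ((w * S)\<^sup>2 - x * (w * D)\<^sup>2)"
    using r by algebra
  also have "\<dots> = w\<^sup>2 * (e * s ^ 4)"
    using t1' t3 unfolding b[symmetric] e_def by algebra
  finally have B: "S\<^sup>2 * V\<^sup>2 * (1 - r) = e * s ^ 4"
    using nz by simp
  have "w\<^sup>2 * (V * e * (y + x * z)) = e * (t1 * t2')"
    unfolding c by algebra
  also have "\<dots> = w\<^sup>2 * (s\<^sup>2 * D\<^sup>2 * S)"
    using t1 t2' unfolding e_def by algebra
  finally have C: "V * e * (y + x * z) = s\<^sup>2 * D\<^sup>2 * S"
    using nz by simp
  have "(w\<^sup>2 * S) * (V * D * (y - x * z)) = D * S * (t1' * t2)"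
    unfolding d by algebra
  also have "\<dots> = (w\<^sup>2 * S) * (s\<^sup>2 * e)"
    using t1' t2 unfolding e_def by algebra
  finally have D: "V * D * (y - x * z) = s\<^sup>2 * e"
    using nz by simp
  have "(e * V\<^sup>2) * ((1 - r\<^sup>2) * S ^ 4) = (e * S\<^sup>2 * (1 + r)) * (S\<^sup>2 * V\<^sup>2 * (1 - r))"
    by algebra
  also have "\<dots> = (e * V\<^sup>2) * (s ^ 6 * D)"
    unfolding A B by algebra
  finally show "(1 - r\<^sup>2) * S ^ 4 = s ^ 6 * D"
    using nz \<open>e \<noteq> 0\<close> by simp
  have "S\<^sup>2 * (s ^ 4 * D ^ 6) = D\<^sup>2 * (s\<^sup>2 * D\<^sup>2 * S)\<^sup>2"
    by algebra
  \<comment> \<open>From (y + xz)^2 = (y - xz)^2 + 4xyz. With \<open>D\<close>, \<open>r\<close> and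
    \<open>B\<close> inserted, the two terms become multiples of 1 - r and 4r, whose sum is 1 +
    3r.\<close>
  also have "\<dots> = e\<^sup>2 * (V * D * (y - x * z))\<^sup>2 + 4 * e ^ 3 * V\<^sup>2 * (x * D\<^sup>2)"
    unfolding C[symmetric] e_def by algebra
  also have "\<dots> = e ^ 3 * (e * s ^ 4) + 4 * e ^ 3 * V\<^sup>2 * (r * S\<^sup>2)"
    unfolding D r by algebra
  also have "\<dots> = S\<^sup>2 * (e ^ 3 * V\<^sup>2 * (1 + 3 * r))"
    unfolding B[symmetric] by algebra
  finally have F: "s ^ 4 * D ^ 6 = e ^ 3 * V\<^sup>2 * (1 + 3 * r)"
    using nz by simp
  have "(1 + 3 * r) * (1 - r) * (e\<^sup>2 * V ^ 4 * S\<^sup>2) = e\<^sup>2 * V\<^sup>2 * (1 + 3 * r) * (S\<^sup>2 * V\<^sup>2 * (1 - r))"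
    by algebra
  also have "\<dots> = s ^ 4 * (s ^ 4 * D ^ 6)"
    unfolding B F by algebra
  finally show "(1 + 3 * r) * (1 - r) * ((y * z)\<^sup>2 * V ^ 4 * S\<^sup>2) = D ^ 6 * s ^ 8"
    unfolding e_def by algebra
qed

lemma E_dissections:
  fixes r :: "rat fps"
  assumes r: "r * (E 4 ^ 4 * E 6 ^ 2) = fps_X * (E 2 ^ 2 * E 12 ^ 4)"
  shows "(1 - r\<^sup>2) * (E 4 ^ 5 * E 12) = E 2 * E 6 ^ 5"
    and "(1 + 3 * r) * (1 - r) * (E 1 ^ 2 * E 3 ^ 2 * E 4 ^ 8) = E 2 ^ 8 * E 6 ^ 4"
proof -
  define p :: "nat \<Rightarrow> rat fps" where "p k = pochhammer_inf k 12" for k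
  have nz: "p k \<noteq> 0" if "k > 0" for k
    using that by (simp add: p_def pochhammer_inf_nonzero)
  \<comment> \<open>The residues k and 12 - k are paired, as they occur together in the triple
    product.\<close>
  define S D V s w y z where "S = p 4 * p 8" and "D = p 2 * p 10" and "V = p 3 * p 9"
    and "s = p 6" and "w = p 12" and "y = p 5 * p 7" and "z = p 1 * p 11"
  note defs = S_def D_def V_def s_def w_def y_def z_def p_def
  have nonzero: "S \<noteq> 0" "V \<noteq> 0" "s \<noteq> 0" "w \<noteq> 0" "y \<noteq> 0" "z \<noteq> 0" "D \<noteq> 0"
    using nz by (simp_all add: S_def D_def V_def s_def w_def y_def z_def)
  have split6: "pochhammer_inf k 6 = p k * p (k + 6)" if "k > 0" for k
    using that by (subst pochhammer_inf_split[of _ _ 2]) (auto simp: p_def numeral_2_eq_2)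
  have split12: "E k = (\<Prod>j<c. p (k + j * k))" if "c * k = 12" for c k
  proof -
    have "c > 0" "k > 0"
      using that by (auto intro: Nat.gr0I)
    then show ?thesis
      using pochhammer_inf_split[of k k c] that by (simp add: E_eq_pochhammer_inf p_def)
  qed
  have lessThan_one: "{..<1 :: nat} = {0}"
    by auto
  have E: "E 1 = y * z * D * V * S * s * w" "E 2 = D * S * s * w" "E 3 = V * s * w" "E 4 = S * w"
      "E 6 = s * w" "E 12 = w"
    using split12[of 12 1] split12[of 6 2] split12[of 4 3] split12[of 3 4] split12[of 2 6] split12[of 1 12]
    by (simp_all add: lessThan_one lessThan_nat_numeral numeral_2_eq_2[symmetric]
        S_def D_def V_def s_def w_def y_def z_def mult_ac del: One_nat_def)
  have t1: "theta 1 5 1 * (y * z) = s * w * D" and t2: "theta 2 4 1 * (D * S) = s * w * S"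
    and t3: "theta 3 3 1 * V\<^sup>2 = s * w * s\<^sup>2"
    using theta_one[where 'a = rat, of 1 5] theta_one[where 'a = rat, of 2 4]
      theta_one[where 'a = rat, of 3 3]
    by (simp_all add: split6 power2_eq_square S_def D_def V_def s_def w_def y_def z_def mult_ac
        del: One_nat_def flip: p_def)
  have t1': "theta 1 5 (-1) = s * w * (y * z)" and t2': "theta 2 4 (-1) = s * w * (D * S)"
    and t3': "theta 3 3 (-1) = s * w * V\<^sup>2"
    by (simp_all add: theta_minus_one split6 power2_eq_square S_def D_def V_def s_def w_def y_def z_def
        mult_ac del: One_nat_def flip: p_def)
  have T: "theta 4 8 (-1) = w * S" "theta 10 2 (-1) = w * D" "theta 3 9 (-1) = w * V" "theta 9 3 (-1) = w * V"
      "theta 5 7 (-1) = w * y" "theta 11 1 (-1) = w * z"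
    by (simp_all add: theta_minus_one defs mult_ac)
  have X: "fps_const (- 1 :: rat) = - 1"
    by (simp flip: fps_const_neg)
  \<comment> \<open>In all four products the two signs are opposite, so only theta series with sign
    -1 appear on the right, and these are plain products of factors 1 - q^k.\<close>
  have a: "theta 1 5 1 * theta 3 3 (-1) = (w * S)\<^sup>2 + fps_X * (w * D)\<^sup>2"
    using theta_mult_theta[of 1 5 3 3 "1 :: rat" "-1"] by (simp add: X T power2_eq_square del: One_nat_def)
  have b: "theta 1 5 (-1) * theta 3 3 1 = (w * S)\<^sup>2 - fps_X * (w * D)\<^sup>2"
    using theta_mult_theta[of 1 5 3 3 "-1 :: rat" 1] by (simp add: X T power2_eq_square del: One_nat_def)
  have c: "theta 1 5 1 * theta 2 4 (-1) = w * V * (w * y + fps_X * (w * z))"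
    using theta_mult_theta[of 1 5 2 4 "1 :: rat" "-1"] by (simp add: X T T[unfolded One_nat_def] algebra_simps del: One_nat_def)
  have d: "theta 1 5 (-1) * theta 2 4 1 = w * V * (w * y - fps_X * (w * z))"
    using theta_mult_theta[of 1 5 2 4 "-1 :: rat" 1] by (simp add: X T T[unfolded One_nat_def] algebra_simps del: One_nat_def)
  have "(S\<^sup>2 * s\<^sup>2 * w ^ 6) * (r * S\<^sup>2) = (S\<^sup>2 * s\<^sup>2 * w ^ 6) * (fps_X * D\<^sup>2)"
    using r unfolding E by algebra
  then have r': "r * S\<^sup>2 = fps_X * D\<^sup>2"
    using nonzero by simp
  note rel = level_12_relations[OF nonzero(1,2,4-6) t1 t1' t2 t2' t3 t3' a b c d r']
  show "(1 - r\<^sup>2) * (E 4 ^ 5 * E 12) = E 2 * E 6 ^ 5"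
    using rel(1) unfolding E by algebra
  show "(1 + 3 * r) * (1 - r) * (E 1 ^ 2 * E 3 ^ 2 * E 4 ^ 8) = E 2 ^ 8 * E 6 ^ 4"
    using rel(2) unfolding E by algebra
qed

section \<open>Even part and conclusion\<close>

lemma fps_unit_divide_mult:
  fixes f g :: "rat fps"
  assumes "fps_nth g 0 \<noteq> 0"
  shows "f / g * g = f"
  using assms by (simp add: fps_divide_unit mult.assoc inverse_mult_eq_1)

theorem theorem2p6:
  shows "U (qsub 2 gamma * delta ^ 2) = 3 * xi ^ 2 - 2 * xi ^ 3"
proof -
  \<comment> \<open>\<open>R\<close> is r/q with q^2 replaced by q, and \<open>H\<close> is likewise
    the eta quotient that remains when (1 + 3r)(1 - r) is split off from the square of
    \<open>delta\<close>.\<close>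
  define R where "R = E 1 ^ 2 * E 6 ^ 4 / (E 2 ^ 4 * E 3 ^ 2)"
  define H where "H = E 2 ^ 10 / (E 6 ^ 2 * E 1 ^ 8)"
  define t where "t = fps_X * R ^ 2"
  define r where "r = fps_X * qsub 2 R"
  have E_nz: "E k \<noteq> 0" if "k > 0" for k
    using E_nth_0[OF that] by (metis fps_zero_nth zero_neq_one)
  have xi: "xi * (E 1 * E 3 ^ 5) = E 2 ^ 5 * E 6"
    unfolding xi_def by (rule fps_unit_divide_mult) (simp add: E_nth_0 fps_power_zeroth)
  have gamma: "gamma * E 3 ^ 15 = E 1 ^ 5 * E 2 ^ 5 * E 6 ^ 5"
    unfolding gamma_def by (rule fps_unit_divide_mult) (simp add: E_nth_0 fps_power_zeroth)
  have delta: "delta * (E 1 * E 3 * E 12) = E 4 * E 6 ^ 2"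
    unfolding delta_def by (rule fps_unit_divide_mult) (simp add: E_nth_0 fps_power_zeroth)
  have R: "R * (E 2 ^ 4 * E 3 ^ 2) = E 1 ^ 2 * E 6 ^ 4"
    unfolding R_def by (rule fps_unit_divide_mult) (simp add: E_nth_0 fps_power_zeroth)
  have H: "H * (E 6 ^ 2 * E 1 ^ 8) = E 2 ^ 10"
    unfolding H_def by (rule fps_unit_divide_mult) (simp add: E_nth_0 fps_power_zeroth)
  note hom = qsub_ring_hom[of 2, simplified] qsub_E
  have qH: "qsub 2 H * (E 12 ^ 2 * E 2 ^ 8) = E 4 ^ 10"
    using arg_cong[OF H, of "qsub 2"] by (simp add: hom)
  have "qsub 2 R * (E 4 ^ 4 * E 6 ^ 2) = E 2 ^ 2 * E 12 ^ 4"
    using arg_cong[OF R, of "qsub 2"] by (simp add: hom)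
  then have "r * (E 4 ^ 4 * E 6 ^ 2) = fps_X * (E 2 ^ 2 * E 12 ^ 4)"
    by (simp add: r_def mult.assoc)
  note dissections = E_dissections[OF this]
  have r2: "r\<^sup>2 = qsub 2 t"
    by (simp add: r_def t_def hom power_mult_distrib)
  \<comment> \<open>In q^2 this is the first dissection: 1 - r^2 is the reciprocal of
    \<open>qsub 2 xi\<close>. Injectivity of q -> q^2 then gives the claim.\<close>
  have xi_t: "xi * (1 - t) = 1"
  proof -
    have "qsub 2 xi * (E 2 * E 6 ^ 5) = E 4 ^ 5 * E 12"
      using arg_cong[OF xi, of "qsub 2"] by (simp add: hom)
    then have "(E 4 ^ 5 * E 12) * (qsub 2 xi * (1 - r\<^sup>2)) = (E 4 ^ 5 * E 12) * 1"
      using dissections(1) by algebra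
    then have "qsub 2 (xi * (1 - t)) = qsub 2 1"
      using E_nz by (simp add: hom r2)
    then show ?thesis
      by (simp only: qsub_2_inject)
  qed
  have "(E 1 ^ 2 * E 3 ^ 2 * E 12 ^ 2 * E 2 ^ 8 * E 4 ^ 8) * delta\<^sup>2
      = E 2 ^ 8 * E 4 ^ 8 * (delta * (E 1 * E 3 * E 12))\<^sup>2"
    by algebra
  also have "\<dots> = E 4 ^ 10 * (E 2 ^ 8 * E 6 ^ 4)"
    unfolding delta by algebra
  also have "\<dots> = (E 1 ^ 2 * E 3 ^ 2 * E 12 ^ 2 * E 2 ^ 8 * E 4 ^ 8) * (qsub 2 H * ((1 + 3 * r) * (1 - r)))"
    unfolding qH[symmetric] dissections(2)[symmetric] by algebra
  finally have "delta\<^sup>2 = qsub 2 H * ((1 + 3 * r) * (1 - r))"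
    using E_nz by simp
  \<comment> \<open>The middle term 2r of (1 + 3r)(1 - r) is q times a series in q^2, hence the odd
    part that \<open>U\<close> discards.\<close>
  also have "\<dots> = qsub 2 H * (1 - 3 * r\<^sup>2) + fps_X * (2 * qsub 2 R * qsub 2 H)"
    unfolding r_def by algebra
  also have "\<dots> = qsub 2 (H * (1 - 3 * t)) + fps_X * qsub 2 (2 * R * H)"
    by (simp add: hom r2)
  finally have "qsub 2 gamma * delta\<^sup>2
      = qsub 2 (gamma * (H * (1 - 3 * t))) + fps_X * qsub 2 (gamma * (2 * R * H))"
    by (simp add: hom distrib_left mult_ac)
  then have "U (qsub 2 gamma * delta\<^sup>2) = gamma * H * (1 - 3 * t)"
    by (simp add: U_even_plus_odd mult.assoc)
  also have "gamma * H = xi ^ 3"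
  proof -
    have "(E 3 ^ 15 * E 6 ^ 2 * E 1 ^ 8) * (gamma * H) = (gamma * E 3 ^ 15) * (H * (E 6 ^ 2 * E 1 ^ 8))"
      by algebra
    also have "\<dots> = E 1 ^ 5 * E 6 ^ 2 * (E 2 ^ 5 * E 6) ^ 3"
      unfolding gamma H by algebra
    also have "\<dots> = (E 3 ^ 15 * E 6 ^ 2 * E 1 ^ 8) * xi ^ 3"
      unfolding xi[symmetric] by algebra
    finally show ?thesis
      using E_nz by simp
  qed
  \<comment> \<open>By \<open>xi_t\<close>, \<open>xi * t\<close> equals \<open>xi - 1\<close>, so
    the left side is \<open>xi ^ 3 - 3 * xi ^ 2 * (xi - 1)\<close>.\<close>
  also have "xi ^ 3 * (1 - 3 * t) = 3 * xi ^ 2 - 2 * xi ^ 3"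
    using xi_t by algebra
  finally show ?thesis .
qed

end
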